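(* For any $0<\mu<1$ there exist $\lambda_0>0$ and $c>0$ such that for any $\lambda$ with $0<\lambda<\lambda_0$ and all large enough $n$, the process $\mathrm{ARW}(\mu,\lambda)$ on $\mathbb{Z}/n\mathbb{Z}$ satisfies $$\mathbb{P}\left(T_n(\mu,\lambda)<e^{cn}\right)<e^{-cn}.$$
   Context: Activated Random Walk (ARW) with sleep rate $\lambda>0$ on the cycle $\mathbb{Z}/n\mathbb{Z}$ (nearest neighbour edges): each particle is either active or asleep. In continuous time each active particle independently performs a simple symmetric random walk at rate one and, at rate $\lambda$, tries to fall asleep; the attempt succeeds (the particle becomes sleepy) if it is the only particle at its site, and has no effect otherwise. A sleepy particle does not move, and becomes active when an active particle occupies the same site. $\mathrm{ARW}(\mu,\lambda)$, for $\mu\in(0,1)$, denotes this process started from the random initial configuration in which each site independently contains a $\mathrm{Bernoulli}(\mu)$ number of particles (one with probability $\mu$, none with probability $1-\mu$), all active. Almost surely the process reaches in finite time a configuration with all particles asleep. $T_n(\mu,\lambda)$ denotes the total number of attempts by any active particle to either jump or try to sleep until that time. Equivalently, $T_n(\mu,\lambda)$ is the absorption time of the discrete-time chain in which at each step an active particle is chosen uniformly at random, and it jumps to each of its two neighbouring sites with probability $\frac{1}{2(1+\lambda)}$ each and tries to fall asleep with probability $\frac{\lambda}{1+\lambda}$. The probability $\mathbb{P}$ is over both the initial configuration and the dynamics. *)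

theory Defs
  imports "HOL-Probability.Probability"
begin

section \<open>Time-homogeneous Markov chains with countably supported transitions\<close>

text \<open>
  The law, on the space of infinite trajectories, of the chain with initial distribution \<open>I\<close>
  and transition kernel \<open>K\<close>. The state space carries the discrete sigma-algebra.
\<close>

definition chain_kernel :: "'s pmf \<Rightarrow> ('s \<Rightarrow> 's pmf) \<Rightarrow> nat \<Rightarrow> (nat \<Rightarrow> 's) \<Rightarrow> 's measure" where
  "chain_kernel I K i \<xi> = (case i of 0 \<Rightarrow> measure_pmf I | Suc j \<Rightarrow> measure_pmf (K (\<xi> j)))"

lemma Ionescu_Tulcea_chain: "Ionescu_Tulcea (chain_kernel I K) (\<lambda>_. count_space UNIV)"
proof (rule Ionescu_Tulcea.intro)
  fix i :: nat
  show "chain_kernel I K i \<in>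
      measurable (PiM {0..<i} (\<lambda>_. count_space UNIV)) (subprob_algebra (count_space UNIV))"
  proof (cases i)
    case 0
    then show ?thesis
      by (auto simp: chain_kernel_def[abs_def] intro!: measurable_const measure_pmf_in_subprob_algebra)
  next
    case (Suc j)
    have "(\<lambda>s. measure_pmf (K s)) \<in> measurable (count_space UNIV) (subprob_algebra (count_space UNIV))"
      by (auto intro: measure_pmf_in_subprob_algebra)
    moreover have "(\<lambda>\<xi>. \<xi> j) \<in> measurable (PiM {0..<i} (\<lambda>_. count_space UNIV)) (count_space UNIV)"
      using Suc by (intro measurable_component_singleton) auto
    ultimately have "(\<lambda>\<xi>. measure_pmf (K (\<xi> j))) \<in>
        measurable (PiM {0..<i} (\<lambda>_. count_space UNIV)) (subprob_algebra (count_space UNIV))"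
      by (rule measurable_compose[rotated])
    then show ?thesis
      by (simp add: chain_kernel_def[abs_def] Suc)
  qed
next
  fix i x
  show "prob_space (chain_kernel I K i x)"
    by (auto simp: chain_kernel_def prob_space_measure_pmf split: nat.split)
qed

global_interpretation chain: Ionescu_Tulcea "chain_kernel I K" "\<lambda>_. count_space UNIV"
  for I :: "'s pmf" and K :: "'s \<Rightarrow> 's pmf"
  defines chain_law = chain.PF.lim
  by (rule Ionescu_Tulcea_chain)

lemma space_chain_law [simp]: "space (chain_law I K) = UNIV"
  by (simp add: chain.PF.space_lim space_PiM PiE_def)

lemma prob_space_chain_law: "prob_space (chain_law I K)"
proof
  interpret CI: prob_space "chain.CI I K {}"
    by (rule chain.PF.prob_space_P) auto
  have "emeasure (chain_law I K) (prod_emb UNIV (\<lambda>_. count_space UNIV) {} (space (PiM {} (\<lambda>_. count_space UNIV))))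
      = emeasure (chain.CI I K {}) (space (PiM {} (\<lambda>_. count_space UNIV)))"
    by (rule chain.lim) auto
  also have "\<dots> = 1"
    using CI.emeasure_space_1 by (simp add: chain.CI_def)
  finally show "emeasure (chain_law I K) (space (chain_law I K)) = 1"
    by (simp add: prod_emb_def space_PiM vimage_def restrict_def)
qed

lemma measurable_chain_component [measurable]:
  "(\<lambda>\<xi>. \<xi> i) \<in> measurable (chain_law I K) (count_space UNIV)"
  by (subst measurable_cong_sets[OF chain.PF.sets_lim refl]) (rule measurable_component_singleton, simp)

lemma measure_chain_law_cylinder:
  "measure (chain_law I K) {\<xi>. \<forall>i\<le>m. \<xi> i = x i}
     = pmf I (x 0) * (\<Prod>i<m. pmf (K (x i)) (x (Suc i)))"
proof -
  let ?N = "\<lambda>_::nat. count_space (UNIV :: 'a set)"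
  define B where "B k = PiE {0..<k} (\<lambda>i. {x i})" for k :: nat
  have B_sets [measurable]: "B k \<in> sets (PiM {0..<k} ?N)" for k
    unfolding B_def by (rule sets_PiM_I_finite) auto
  have u: "(\<lambda>_. undefined) \<in> space (PiM {0..<0} ?N)"
    by (simp add: space_PiM)
  have step: "emeasure (chain.C I K 0 (Suc k) (\<lambda>_. undefined)) (B (Suc k))
     = emeasure (chain.C I K 0 k (\<lambda>_. undefined)) (B k) * emeasure (chain_kernel I K k x) {x k}" for k
  proof -
    have C_space: "space (chain.C I K 0 k (\<lambda>_. undefined)) = space (PiM {0..<k} ?N)"
      using chain.space_C[OF u] by simp
    have C_sets: "sets (chain.C I K 0 k (\<lambda>_. undefined)) = sets (PiM {0..<k} ?N)"
      using chain.sets_C[OF u] by simp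
    have "emeasure (chain.C I K 0 (Suc k) (\<lambda>_. undefined)) (B (Suc k))
       = (\<integral>\<^sup>+\<xi>. emeasure (chain.eP I K k \<xi>) (B (Suc k)) \<partial>chain.C I K 0 k (\<lambda>_. undefined))"
    proof -
      have "chain.eP I K k \<in> measurable (chain.C I K 0 k (\<lambda>_. undefined))
              (subprob_algebra (PiM {0..<Suc k} ?N))"
        using chain.measurable_eP[of I K k] by (subst measurable_cong_sets[OF C_sets refl])
      moreover have "space (chain.C I K 0 k (\<lambda>_. undefined)) \<noteq> {}"
        by (simp add: C_space space_PiM PiE_eq_empty_iff)
      ultimately show ?thesis
        by (simp add: emeasure_bind[OF _ _ B_sets])
    qed
    also have "\<dots> = (\<integral>\<^sup>+\<xi>. emeasure (chain_kernel I K k x) {x k} * indicator (B k) \<xi>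
                      \<partial>chain.C I K 0 k (\<lambda>_. undefined))"
    proof (rule nn_integral_cong)
      fix \<xi> assume "\<xi> \<in> space (chain.C I K 0 k (\<lambda>_. undefined))"
      then have \<xi>: "\<xi> \<in> space (PiM {0..<k} ?N)"
        by (simp add: C_space)
      have eq: "fun_upd \<xi> k -` B (Suc k) = (if \<xi> \<in> B k then {x k} else {})"
      proof -
        have "\<xi>(k := y) \<in> B (Suc k) \<longleftrightarrow> \<xi> \<in> B k \<and> y = x k" for y
          using \<xi> by (auto simp: B_def PiE_iff extensional_def space_PiM less_Suc_eq)
        then show ?thesis by auto
      qed
      have ker: "chain_kernel I K k \<xi> = chain_kernel I K k x" if "\<xi> \<in> B k"
        using that by (cases k) (auto simp: chain_kernel_def B_def PiE_iff)
      show "emeasure (chain.eP I K k \<xi>) (B (Suc k))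
          = emeasure (chain_kernel I K k x) {x k} * indicator (B k) \<xi>"
        using chain.emeasure_eP[OF \<xi> B_sets, of I K] eq ker by auto
    qed
    also have "\<dots> = emeasure (chain_kernel I K k x) {x k} * emeasure (chain.C I K 0 k (\<lambda>_. undefined)) (B k)"
      by (rule nn_integral_cmult_indicator) (simp add: C_sets)
    finally show ?thesis
      by (simp add: mult.commute)
  qed
  have base: "emeasure (chain.C I K 0 0 (\<lambda>_. undefined)) (B 0) = 1"
    using B_sets[of 0] by (simp add: B_def)
  have ker_0: "emeasure (chain_kernel I K 0 x) {x 0} = ennreal (pmf I (x 0))"
    and ker_Suc: "emeasure (chain_kernel I K (Suc k) x) {x (Suc k)} = ennreal (pmf (K (x k)) (x (Suc k)))" for k
    by (simp_all add: chain_kernel_def emeasure_pmf_single)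
  have prods: "emeasure (chain.C I K 0 (Suc k) (\<lambda>_. undefined)) (B (Suc k))
     = ennreal (pmf I (x 0) * (\<Prod>i<k. pmf (K (x i)) (x (Suc i))))" for k
  proof (induction k)
    case 0
    then show ?case
      unfolding step[of 0] base ker_0 by simp
  next
    case (Suc k)
    show ?case
      unfolding step[of "Suc k"] Suc.IH ker_Suc
      by (simp add: ennreal_mult[symmetric] prod_nonneg mult.assoc)
  qed
  have cyl: "{\<xi>. \<forall>i\<le>m. \<xi> i = x i} = prod_emb UNIV ?N {0..<Suc m} (B (Suc m))"
    by (auto simp: prod_emb_def B_def PiE_iff)
  have "emeasure (chain_law I K) {\<xi>. \<forall>i\<le>m. \<xi> i = x i} = emeasure (chain.CI I K {0..<Suc m}) (B (Suc m))"
    unfolding cyl by (rule chain.lim) (auto intro: B_sets)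
  also have "\<dots> = emeasure (chain.C I K 0 (Suc m) (\<lambda>_. undefined)) (B (Suc m))"
    using chain.emeasure_CI[OF order_refl B_sets] prod_emb_id[OF sets.sets_into_space[OF B_sets, unfolded space_PiM]]
    by (simp del: chain.C.simps)
  also have "\<dots> = ennreal (pmf I (x 0) * (\<Prod>i<m. pmf (K (x i)) (x (Suc i))))"
    by (rule prods)
  finally show ?thesis
    by (simp add: measure_def prod_nonneg)
qed


section \<open>Activated random walk on the cycle\<close>

text \<open>
  \<open>Active k\<close>: the site holds \<open>k\<close> particles, all active (\<open>Active 0\<close> is an empty site).
  \<open>Sleepy\<close>: the site holds exactly one particle, which is asleep.
  No other site states occur, since a sleepy particle is alone at its site.
\<close>

datatype site_state = Active nat | Sleepy

fun num_active :: "site_state \<Rightarrow> nat" where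
  "num_active (Active k) = k"
| "num_active Sleepy = 0"

fun add_active :: "site_state \<Rightarrow> site_state" where
  "add_active (Active k) = Active (Suc k)"
| "add_active Sleepy = Active 2"

fun remove_active :: "site_state \<Rightarrow> site_state" where
  "remove_active (Active k) = Active (k - 1)"
| "remove_active Sleepy = Sleepy"

fun try_sleep :: "site_state \<Rightarrow> site_state" where
  "try_sleep (Active k) = (if k = 1 then Sleepy else Active k)"
| "try_sleep Sleepy = Sleepy"

text \<open>
  A configuration on \<open>\<int>/n\<int>\<close> is given by its values on the representatives \<open>0, \<dots>, n - 1\<close>;
  all other values are irrelevant, and are \<open>Active 0\<close> in the initial configuration.
\<close>

type_synonym configuration = "nat \<Rightarrow> site_state"

definition stable :: "nat \<Rightarrow> configuration \<Rightarrow> bool" where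
  "stable n \<eta> \<longleftrightarrow> (\<forall>x<n. num_active (\<eta> x) = 0)"

text \<open>The pair \<open>(x, i)\<close> stands for the \<open>i\<close>-th of the active particles at site \<open>x\<close>.\<close>

definition active_particles :: "nat \<Rightarrow> configuration \<Rightarrow> (nat \<times> nat) set" where
  "active_particles n \<eta> = (SIGMA x:{..<n}. {..<num_active (\<eta> x)})"

lemma finite_active_particles [simp]: "finite (active_particles n \<eta>)"
  by (simp add: active_particles_def)

lemma active_particles_eq_empty_iff: "active_particles n \<eta> = {} \<longleftrightarrow> stable n \<eta>"
  by (auto simp: active_particles_def stable_def)

datatype action = Jump_left | Jump_right | Try_sleep

definition action_pmf :: "real \<Rightarrow> action pmf" where
  "action_pmf lam = do {
     s \<leftarrow> bernoulli_pmf (lam / (1 + lam));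
     if s then return_pmf Try_sleep else pmf_of_set {Jump_left, Jump_right}
   }"

lemma pmf_action_pmf:
  assumes "lam > 0"
  shows "pmf (action_pmf lam) Jump_left = 1 / (2 * (1 + lam))"
    and "pmf (action_pmf lam) Jump_right = 1 / (2 * (1 + lam))"
    and "pmf (action_pmf lam) Try_sleep = lam / (1 + lam)"
  using assms by (auto simp: action_pmf_def pmf_bind field_simps)

definition jump :: "nat \<Rightarrow> nat \<Rightarrow> configuration \<Rightarrow> configuration" where
  "jump x y \<eta> = (let \<eta>' = \<eta>(x := remove_active (\<eta> x)) in \<eta>'(y := add_active (\<eta>' y)))"

fun perform :: "nat \<Rightarrow> nat \<Rightarrow> action \<Rightarrow> configuration \<Rightarrow> configuration" where
  "perform n x Jump_left \<eta> = jump x ((x + n - 1) mod n) \<eta>"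
| "perform n x Jump_right \<eta> = jump x ((x + 1) mod n) \<eta>"
| "perform n x Try_sleep \<eta> = \<eta>(x := try_sleep (\<eta> x))"

definition arw_step :: "nat \<Rightarrow> real \<Rightarrow> configuration \<Rightarrow> configuration pmf" where
  "arw_step n lam \<eta> =
     (if stable n \<eta> then return_pmf \<eta>
      else do {
        (x, i) \<leftarrow> pmf_of_set (active_particles n \<eta>);
        a \<leftarrow> action_pmf lam;
        return_pmf (perform n x a \<eta>)
      })"

definition arw_initial :: "nat \<Rightarrow> real \<Rightarrow> configuration pmf" where
  "arw_initial n \<mu> =
     Pi_pmf {..<n} (Active 0) (\<lambda>_. map_pmf (\<lambda>b. Active (of_bool b)) (bernoulli_pmf \<mu>))"

text \<open>
  The chain lists the configurations seen at time 0 and after each attempt of an active particle to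
  jump or to fall asleep; it is the continuous-time process (per active particle: jumps at rate 1,
  sleep attempts at rate \<open>lam\<close>) observed at its successive attempts. Attempts that leave the
  configuration unchanged are time steps too, so the total number of attempts until all particles
  are asleep is the hitting time \<open>total_attempts\<close> of the stable configurations.
\<close>

definition ARW :: "nat \<Rightarrow> real \<Rightarrow> real \<Rightarrow> (nat \<Rightarrow> configuration) measure" where
  "ARW n \<mu> lam = chain_law (arw_initial n \<mu>) (arw_step n lam)"

definition total_attempts :: "nat \<Rightarrow> (nat \<Rightarrow> configuration) \<Rightarrow> enat" where
  "total_attempts n \<xi> = Inf {enat k | k. stable n (\<xi> k)}"

lemma space_ARW [simp]: "space (ARW n \<mu> lam) = UNIV"
  by (simp only: ARW_def space_chain_law)

lemma prob_space_ARW: "prob_space (ARW n \<mu> lam)"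
  by (simp only: ARW_def prob_space_chain_law)

lemma total_attempts_less_iff:
  "ereal_of_enat (total_attempts n \<xi>) < ereal r \<longleftrightarrow> (\<exists>k. real k < r \<and> stable n (\<xi> k))"
proof
  assume *: "ereal_of_enat (total_attempts n \<xi>) < ereal r"
  then have "{enat k | k. stable n (\<xi> k)} \<noteq> {}"
    unfolding total_attempts_def by (intro notI) (simp add: Inf_enat_def)
  then have "total_attempts n \<xi> \<in> {enat k | k. stable n (\<xi> k)}"
    unfolding total_attempts_def Inf_enat_def by (auto intro: LeastI)
  then show "\<exists>k. real k < r \<and> stable n (\<xi> k)"
    using * by auto
next
  assume "\<exists>k. real k < r \<and> stable n (\<xi> k)"
  then obtain k where k: "real k < r" "stable n (\<xi> k)" by blast
  then have "total_attempts n \<xi> \<le> enat k"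
    unfolding total_attempts_def by (intro Inf_lower) auto
  then have "ereal_of_enat (total_attempts n \<xi>) \<le> ereal (real k)"
    by (metis ereal_of_enat_le_iff ereal_of_enat_simps(1))
  with k show "ereal_of_enat (total_attempts n \<xi>) < ereal r"
    by (meson ereal_less_eq(3) le_less_trans less_ereal.simps(1))
qed

lemma sets_total_attempts_less:
  "{\<xi> \<in> space (ARW n \<mu> lam). ereal_of_enat (total_attempts n \<xi>) < ereal r} \<in> sets (ARW n \<mu> lam)"
proof -
  have [measurable]: "Measurable.pred (ARW n \<mu> lam) (\<lambda>\<xi>. stable n (\<xi> k))" for k
    unfolding ARW_def by (rule measurable_compose[OF measurable_chain_component]) simp
  show ?thesis
    unfolding total_attempts_less_iff by measurable
qed

end

(*
  If sleep instructions outside the final set A of sleepers are ignored, the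
  run that ends in A is unchanged. For a fixed A, with one site per particle, the sites may be toppled
  in any order (abelian property): particles are moved until they fill A, and then always the leftmost
  active particle is toppled. The sleepers then form a prefix x_1 < ... < x_k of A, up to further waking,
  and the particle at x_(k+1) falls asleep before it wakes the one at x_k with odds 2 lam g_k, where
  g_k = x_(k+1) - x_k. Hence the prefix length is dominated by a birth-death chain which reaches
  N = |A| within t steps with probability at most t * prod g_k * (2 lam)^(N - 1)
  <= t * exp n * (2 lam)^(N - 1), as g_k <= exp g_k and the g_k add up to at most n. For small lam this
  beats the 2^n choices of A, because N is of order n up to an exponentially small probability.
*)
theory Submission
  imports Defs
begin

section \<open>Marginals of a chain\<close>

text \<open>The last of the first \<open>Suc k\<close> coordinates is one draw from the kernel at
  the state before it. Integrating this draw out replaces \<open>h\<close> by its one-step mean, so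
  the induction needs \<open>h\<close> arbitrary.\<close>

lemma nn_integral_chain_prefix:
  "(\<integral>\<^sup>+\<omega>. h (\<omega> k) \<partial>chain.C I K 0 (Suc k) (\<lambda>_. undefined))
     = (\<integral>\<^sup>+\<eta>. ((\<lambda>g s. \<integral>\<^sup>+s'. g s' \<partial>measure_pmf (K s)) ^^ k) h \<eta> \<partial>measure_pmf I)"
proof (induction k arbitrary: h)
  let ?N = "\<lambda>_::nat. count_space (UNIV :: 'a set)"
  have u: "(\<lambda>_. undefined) \<in> space (PiM {0..<0} ?N)"
    by (simp add: space_PiM)
  have step: "(\<integral>\<^sup>+\<omega>. h (\<omega> k) \<partial>chain.C I K 0 (Suc k) (\<lambda>_. undefined))
     = (\<integral>\<^sup>+\<omega>. (\<integral>\<^sup>+s. h s \<partial>chain_kernel I K k \<omega>) \<partial>chain.C I K 0 k (\<lambda>_. undefined))"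
    for h :: "'a \<Rightarrow> ennreal" and k
  proof -
    have C_space: "space (chain.C I K 0 k (\<lambda>_. undefined)) = space (PiM {0..<k} ?N)"
      using chain.space_C[OF u] by simp
    have C_sets: "sets (chain.C I K 0 k (\<lambda>_. undefined)) = sets (PiM {0..<k} ?N)"
      using chain.sets_C[OF u] by simp
    have eP: "chain.eP I K k \<in> measurable (chain.C I K 0 k (\<lambda>_. undefined))
              (subprob_algebra (PiM {0..<Suc k} ?N))"
      using chain.measurable_eP[of I K k] by (subst measurable_cong_sets[OF C_sets refl])
    have h: "(\<lambda>\<omega>. h (\<omega> k)) \<in> borel_measurable (PiM {0..<Suc k} ?N)"
      by (rule measurable_compose[OF measurable_component_singleton]) auto
    have "(\<integral>\<^sup>+\<omega>. h (\<omega> k) \<partial>chain.C I K 0 (Suc k) (\<lambda>_. undefined))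
       = (\<integral>\<^sup>+\<omega>. (\<integral>\<^sup>+\<omega>'. h (\<omega>' k) \<partial>chain.eP I K k \<omega>) \<partial>chain.C I K 0 k (\<lambda>_. undefined))"
      using nn_integral_bind[OF h eP] by simp
    also have "\<dots> = (\<integral>\<^sup>+\<omega>. (\<integral>\<^sup>+s. h s \<partial>chain_kernel I K k \<omega>) \<partial>chain.C I K 0 k (\<lambda>_. undefined))"
    proof (rule nn_integral_cong)
      fix \<omega> assume "\<omega> \<in> space (chain.C I K 0 k (\<lambda>_. undefined))"
      then have \<omega>: "\<omega> \<in> space (PiM {0..<k} ?N)"
        by (simp add: C_space)
      have sets_k: "sets (chain_kernel I K k \<omega>) = sets (count_space UNIV)"
        by (auto simp: chain_kernel_def split: nat.split)
      have upd: "fun_upd \<omega> k \<in> measurable (chain_kernel I K k \<omega>) (PiM {0..<Suc k} ?N)"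
        using \<omega> by (auto simp: measurable_cong_sets[OF sets_k refl] space_PiM PiE_iff extensional_def)
      show "(\<integral>\<^sup>+\<omega>'. h (\<omega>' k) \<partial>chain.eP I K k \<omega>) = (\<integral>\<^sup>+s. h s \<partial>chain_kernel I K k \<omega>)"
        unfolding chain.eP_def by (subst nn_integral_distr[OF upd]) (use h in simp_all)
    qed
    finally show ?thesis .
  qed
  {
    case 0
    show ?case
      unfolding step[where k = 0] unfolding chain.C.simps
      by (simp add: chain_kernel_def nn_integral_return[OF u])
  next
    case (Suc k)
    have ker: "chain_kernel I K (Suc k) \<omega> = measure_pmf (K (\<omega> k))" for \<omega>
      by (simp add: chain_kernel_def)
    show ?case
      unfolding step[where k = "Suc k"] ker funpow_Suc_right comp_def
      by (rule Suc.IH)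
  }
qed

text \<open>Expresses an event at a single time through iterates of the transition operator, so that
  its probability can be bounded by induction on time from an arbitrary starting state.\<close>

lemma emeasure_chain_law_marginal:
  "emeasure (chain_law I K) {\<xi>. \<xi> k \<in> S}
     = (\<integral>\<^sup>+\<eta>. ((\<lambda>g s. \<integral>\<^sup>+s'. g s' \<partial>measure_pmf (K s)) ^^ k) (indicator S) \<eta> \<partial>measure_pmf I)"
proof -
  let ?N = "\<lambda>_::nat. count_space (UNIV :: 'a set)"
  define B where "B = {\<omega> \<in> space (PiM {0..<Suc k} ?N). \<omega> k \<in> S}"
  have B: "B \<in> sets (PiM {0..<Suc k} ?N)"
  proof -
    have "(\<lambda>\<omega>. \<omega> k) -` S \<inter> space (PiM {0..<Suc k} ?N) \<in> sets (PiM {0..<Suc k} ?N)"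
      by (rule measurable_sets[OF measurable_component_singleton]) auto
    also have "(\<lambda>\<omega>. \<omega> k) -` S \<inter> space (PiM {0..<Suc k} ?N) = B"
      by (auto simp: B_def)
    finally show ?thesis .
  qed
  have u: "(\<lambda>_. undefined) \<in> space (PiM {0..<0} ?N)"
    by (simp add: space_PiM)
  have C_space: "space (chain.C I K 0 (Suc k) (\<lambda>_. undefined)) = space (PiM {0..<Suc k} ?N)"
    using chain.space_C[OF u, of I K "Suc k"] by (simp del: chain.C.simps)
  have C_sets: "sets (chain.C I K 0 (Suc k) (\<lambda>_. undefined)) = sets (PiM {0..<Suc k} ?N)"
    using chain.sets_C[OF u, of I K "Suc k"] by (simp del: chain.C.simps)
  have "{\<xi>. \<xi> k \<in> S} = prod_emb UNIV ?N {0..<Suc k} B"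
    by (auto simp: prod_emb_def B_def space_PiM PiE_iff)
  then have "emeasure (chain_law I K) {\<xi>. \<xi> k \<in> S} = emeasure (chain.CI I K {0..<Suc k}) B"
    by (simp only:) (rule chain.lim, auto intro: B)
  also have "\<dots> = emeasure (chain.C I K 0 (Suc k) (\<lambda>_. undefined)) B"
    using chain.emeasure_CI[OF order_refl B] prod_emb_id[OF sets.sets_into_space[OF B, unfolded space_PiM]]
    by (simp del: chain.C.simps)
  also have "\<dots> = (\<integral>\<^sup>+\<omega>. indicator B \<omega> \<partial>chain.C I K 0 (Suc k) (\<lambda>_. undefined))"
    using B C_sets by (simp del: chain.C.simps)
  also have "\<dots> = (\<integral>\<^sup>+\<omega>. indicator S (\<omega> k) \<partial>chain.C I K 0 (Suc k) (\<lambda>_. undefined))"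
    by (rule nn_integral_cong) (simp only: C_space, auto simp: B_def indicator_def)
  also have "\<dots> = (\<integral>\<^sup>+\<eta>. ((\<lambda>g s. \<integral>\<^sup>+s'. g s' \<partial>measure_pmf (K s)) ^^ k) (indicator S) \<eta> \<partial>measure_pmf I)"
    by (rule nn_integral_chain_prefix)
  finally show ?thesis .
qed

section \<open>The abelian property\<close>

text \<open>The mean over \<open>action_pmf\<close> as an explicit real sum, which makes the later
  balance identities pure algebra.\<close>

definition action_mean :: "real \<Rightarrow> (action \<Rightarrow> real) \<Rightarrow> real" where
  "action_mean lam \<phi> =
     1 / (2 * (1 + lam)) * (\<phi> Jump_left + \<phi> Jump_right) + lam / (1 + lam) * \<phi> Try_sleep"

lemma action_mean_nonneg: "lam > 0 \<Longrightarrow> (\<And>a. \<phi> a \<ge> 0) \<Longrightarrow> action_mean lam \<phi> \<ge> 0"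
  by (simp add: action_mean_def)

lemma action_mean_le_const:
  assumes "lam > 0" and "\<And>a. \<phi> a \<le> C"
  shows "action_mean lam \<phi> \<le> C"
proof -
  have "action_mean lam \<phi> \<le> 1 / (2 * (1 + lam)) * (C + C) + lam / (1 + lam) * C"
    unfolding action_mean_def using assms by (intro add_mono mult_left_mono) auto
  also have "\<dots> = C"
    using assms(1) by (simp add: divide_simps) (simp add: algebra_simps)
  finally show ?thesis .
qed

text \<open>A finite Fubini theorem: the instructions used at two topplings are independent.\<close>

lemma action_mean_swap:
  "action_mean lam (\<lambda>a. action_mean lam (\<lambda>b. \<phi> a b)) = action_mean lam (\<lambda>b. action_mean lam (\<lambda>a. \<phi> a b))"
proof -
  define p q where "p = 1 / (2 * (1 + lam))" and "q = lam / (1 + lam)"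
  show ?thesis
    unfolding action_mean_def p_def[symmetric] q_def[symmetric] by (simp add: algebra_simps)
qed

lemma action_mean_sum:
  "action_mean lam (\<lambda>a. \<Sum>i\<in>S. \<phi> i a) = (\<Sum>i\<in>S. action_mean lam (\<phi> i))"
  unfolding action_mean_def by (simp only: sum.distrib sum_distrib_left[symmetric])

lemma nn_integral_action_pmf:
  assumes "lam > 0" and "\<And>a. \<phi> a \<ge> 0"
  shows "(\<integral>\<^sup>+a. ennreal (\<phi> a) \<partial>measure_pmf (action_pmf lam)) = ennreal (action_mean lam \<phi>)"
proof -
  have fin: "finite (set_pmf (action_pmf lam))"
    by (rule finite_subset[of _ "{Jump_left, Jump_right, Try_sleep}"]) (auto intro: action.exhaust)
  have "(\<integral>\<^sup>+a. ennreal (\<phi> a) \<partial>measure_pmf (action_pmf lam))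
      = ennreal (\<integral>a. \<phi> a \<partial>measure_pmf (action_pmf lam))"
    using assms fin by (intro nn_integral_eq_integral integrable_measure_pmf_finite) auto
  also have "(\<integral>a. \<phi> a \<partial>measure_pmf (action_pmf lam))
      = (\<Sum>a\<in>{Jump_left, Jump_right, Try_sleep}. \<phi> a * pmf (action_pmf lam) a)"
    by (rule integral_measure_pmf_real) (auto intro: action.exhaust)
  also have "\<dots> = action_mean lam \<phi>"
  proof -
    define p q where "p = 1 / (2 * (1 + lam))" and "q = lam / (1 + lam)"
    have "pmf (action_pmf lam) Jump_left = p" "pmf (action_pmf lam) Jump_right = p"
      "pmf (action_pmf lam) Try_sleep = q"
      using pmf_action_pmf[OF assms(1)] by (simp_all only: p_def q_def)
    then show ?thesis
      unfolding action_mean_def p_def[symmetric] q_def[symmetric] by (simp add: algebra_simps)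
  qed
  finally show ?thesis .
qed

text \<open>An ignored sleep instruction still uses up a time step, so this dynamics and the
  original one run on the same clock.\<close>

definition perform_on :: "nat set \<Rightarrow> nat \<Rightarrow> nat \<Rightarrow> action \<Rightarrow> configuration \<Rightarrow> configuration" where
  "perform_on A n x a \<eta> = (if a = Try_sleep \<and> x \<notin> A then \<eta> else perform n x a \<eta>)"

text \<open>An instruction is split into its effect on the toppled site and the site, if any, that
  receives a particle. Commutation can then be checked one site at a time.\<close>

fun own_effect :: "bool \<Rightarrow> action \<Rightarrow> site_state \<Rightarrow> site_state" where
  "own_effect b Try_sleep s = (if b then try_sleep s else s)"
| "own_effect b _ s = remove_active s"

fun target :: "nat \<Rightarrow> nat \<Rightarrow> action \<Rightarrow> nat option" where
  "target n x Jump_left = Some ((x + n - 1) mod n)"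
| "target n x Jump_right = Some ((x + 1) mod n)"
| "target n x Try_sleep = None"

section \<open>Commutation of topplings at distinct sites\<close>

lemma perform_on_apply:
  "perform_on A n x a \<eta> w =
     (let s = (if w = x then own_effect (x \<in> A) a (\<eta> w) else \<eta> w)
      in if target n x a = Some w then add_active s else s)"
  by (cases a) (auto simp: perform_on_def jump_def Let_def)

lemma num_active_add_active: "num_active (add_active s) > 0"
  by (cases s) auto

text \<open>The critical case is a lone particle told to sleep: falling asleep and then being woken
  by the arrival gives two active particles, and so does the arrival followed by a failed
  attempt.\<close>

lemma own_effect_add_active:
  "num_active s > 0 \<Longrightarrow> own_effect b a (add_active s) = add_active (own_effect b a s)"
  by (cases s; cases a) auto

lemma num_active_perform_on:
  "x \<noteq> y \<Longrightarrow> num_active (\<eta> y) > 0 \<Longrightarrow> num_active (perform_on A n x a \<eta> y) > 0"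
  by (simp add: perform_on_apply num_active_add_active Let_def)

text \<open>The local abelian property. As both sites are active, an arrival from one commutes with
  the instruction at the other by \<open>own_effect_add_active\<close>; all other sites see arrivals
  only.\<close>

lemma perform_on_commute:
  assumes "x \<noteq> y" and "num_active (\<eta> x) > 0" and "num_active (\<eta> y) > 0"
  shows "perform_on A n x a (perform_on A n y b \<eta>) = perform_on A n y b (perform_on A n x a \<eta>)"
  using assms by (intro ext) (auto simp: perform_on_apply Let_def own_effect_add_active)

text \<open>
  The probability to be stable at time \<open>t\<close> when a fixed rule picks the site to be toppled and sleep
  instructions off \<open>A\<close> are ignored.
\<close>

fun absorbed :: "nat set \<Rightarrow> nat \<Rightarrow> real \<Rightarrow> nat \<Rightarrow> configuration \<Rightarrow> real" where
  "absorbed A n lam 0 \<eta> = of_bool (stable n \<eta>)"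
| "absorbed A n lam (Suc t) \<eta> =
     (if stable n \<eta> then 1
      else action_mean lam
        (\<lambda>a. absorbed A n lam t (perform_on A n (LEAST x. x < n \<and> num_active (\<eta> x) > 0) a \<eta>)))"

declare absorbed.simps(2) [simp del]

lemma absorbed_nonneg: "lam > 0 \<Longrightarrow> absorbed A n lam t \<eta> \<ge> 0"
  by (induction t arbitrary: \<eta>) (auto simp: absorbed.simps(2) intro: action_mean_nonneg)

lemma absorbed_stable: "stable n \<eta> \<Longrightarrow> absorbed A n lam t \<eta> = 1"
  by (cases t) (auto simp: absorbed.simps(2))

text \<open>Toppling \<open>x\<close> leaves the leftmost active site \<open>y\<close> active, and
  conversely, so the two topplings can be exchanged; induction on \<open>t\<close> moves
  \<open>x\<close> to the front.\<close>

lemma absorbed_Suc: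
  assumes "x < n" and "num_active (\<eta> x) > 0"
  shows "absorbed A n lam (Suc t) \<eta> = action_mean lam (\<lambda>a. absorbed A n lam t (perform_on A n x a \<eta>))"
  using assms
proof (induction t arbitrary: \<eta> x)
  case (0 \<eta> x)
  define y where "y = (LEAST x. x < n \<and> num_active (\<eta> x) > 0)"
  have y: "y < n" "num_active (\<eta> y) > 0"
    using LeastI[of "\<lambda>x. x < n \<and> num_active (\<eta> x) > 0" x] 0 by (auto simp: y_def)
  have ns: "\<not> stable n \<eta>"
    using 0 by (auto simp: stable_def)
  show ?case
  proof (cases "x = y")
    case True
    then show ?thesis using ns by (simp add: y_def absorbed.simps(2))
  next
    case False
    \<comment> \<open>After either toppling the other site is still active, so both sides
      vanish.\<close>
    have "\<not> stable n (perform_on A n x a \<eta>)" "\<not> stable n (perform_on A n y a \<eta>)" for a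
      using num_active_perform_on[of x y \<eta> A n a] num_active_perform_on[of y x \<eta> A n a] 0 y False
      by (auto simp: stable_def)
    then show ?thesis using ns by (simp add: absorbed.simps(2) flip: y_def)
  qed
next
  case (Suc t \<eta> x)
  define y where "y = (LEAST x. x < n \<and> num_active (\<eta> x) > 0)"
  have y: "y < n" "num_active (\<eta> y) > 0"
    using LeastI[of "\<lambda>x. x < n \<and> num_active (\<eta> x) > 0" x] Suc.prems by (auto simp: y_def)
  have ns: "\<not> stable n \<eta>"
    using Suc.prems by (auto simp: stable_def)
  have unfold: "absorbed A n lam (Suc (Suc t)) \<eta>
      = action_mean lam (\<lambda>b. absorbed A n lam (Suc t) (perform_on A n y b \<eta>))"
    unfolding absorbed.simps(2)[of _ _ _ "Suc t" \<eta>] y_def using ns by simp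
  show ?case
  proof (cases "x = y")
    case True
    then show ?thesis using unfold by simp
  next
    case False
    \<comment> \<open>The induction hypothesis topples \<open>x\<close> right after
      \<open>y\<close>; after the exchange it is read backwards, for \<open>y\<close>.\<close>
    have "absorbed A n lam (Suc (Suc t)) \<eta> = action_mean lam (\<lambda>b. action_mean lam
        (\<lambda>a. absorbed A n lam t (perform_on A n x a (perform_on A n y b \<eta>))))"
      unfolding unfold using Suc.prems False
      by (subst Suc.IH[of x]) (auto intro: num_active_perform_on)
    also have "\<dots> = action_mean lam (\<lambda>a. action_mean lam
        (\<lambda>b. absorbed A n lam t (perform_on A n y b (perform_on A n x a \<eta>))))"
      using perform_on_commute[OF False Suc.prems(2) y(2)] by (subst action_mean_swap) simp
    also have "\<dots> = action_mean lam (\<lambda>a. absorbed A n lam (Suc t) (perform_on A n x a \<eta>))"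
      using y False by (subst Suc.IH[of y]) (auto intro: num_active_perform_on)
    finally show ?thesis .
  qed
qed

section \<open>Summing over the final set of sleepers\<close>

fun mass :: "site_state \<Rightarrow> nat" where
  "mass (Active k) = k"
| "mass Sleepy = 1"

definition particles :: "nat \<Rightarrow> configuration \<Rightarrow> nat" where
  "particles n \<eta> = (\<Sum>x<n. mass (\<eta> x))"

lemma mass_add_active: "mass (add_active s) = Suc (mass s)"
  by (cases s) auto

lemma mass_own_effect:
  "num_active s > 0 \<Longrightarrow> mass (own_effect b a s) + of_bool (a \<noteq> Try_sleep) = mass s"
  by (cases s; cases a) auto

lemma sum_target:
  assumes "x < n"
  shows "(\<Sum>w<n. of_bool (target n x a = Some w)) = (of_bool (a \<noteq> Try_sleep) :: nat)"
proof -
  have "(\<Sum>w<n. of_bool (y = w)) = (1 :: nat)" if "y < n" for y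
    using that by (simp add: of_bool_def)
  then show ?thesis
    using assms by (cases a) auto
qed

lemma particles_perform_on:
  assumes "x < n" and "num_active (\<eta> x) > 0"
  shows "particles n (perform_on A n x a \<eta>) = particles n \<eta>"
proof -
  let ?\<eta>' = "\<eta>(x := own_effect (x \<in> A) a (\<eta> x))"
  have "mass (perform_on A n x a \<eta> w) = mass (?\<eta>' w) + of_bool (target n x a = Some w)" for w
    by (simp add: perform_on_apply mass_add_active Let_def)
  then have "particles n (perform_on A n x a \<eta>) = particles n ?\<eta>' + of_bool (a \<noteq> Try_sleep)"
    using sum_target[OF assms(1)] by (simp add: particles_def sum.distrib)
  also have "\<dots> = particles n \<eta>"
    using mass_own_effect[OF assms(2), of "x \<in> A" a] assms(1)
    by (simp add: particles_def sum.remove[of "{..<n}" x])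
  finally show ?thesis .
qed

section \<open>Comparison of the process with its modification for a given set\<close>

definition wake :: "nat set \<Rightarrow> configuration \<Rightarrow> configuration" where
  "wake A \<eta> = (\<lambda>x. if x \<notin> A \<and> \<eta> x = Sleepy then Active 1 else \<eta> x)"

lemma perform_eq_perform_on: "perform n x a \<eta> = perform_on UNIV n x a \<eta>"
  by (simp add: perform_on_def)

lemma num_active_wake: "num_active (\<eta> x) > 0 \<Longrightarrow> num_active (wake A \<eta> x) > 0"
  by (simp add: wake_def)

text \<open>Off \<open>A\<close>, waking identifies \<open>Sleepy\<close> with
  \<open>Active 1\<close>: an arrival turns both into two active particles, and a successful sleep
  attempt becomes invisible.\<close>

lemma wake_perform:
  assumes "num_active (\<eta> x) > 0"
  shows "wake A (perform n x a \<eta>) = perform_on A n x a (wake A \<eta>)"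
proof
  fix w
  show "wake A (perform n x a \<eta>) w = perform_on A n x a (wake A \<eta>) w"
    using assms unfolding perform_eq_perform_on wake_def perform_on_apply Let_def
    by (cases "\<eta> w"; cases a) (auto split: if_splits)
qed

definition arw_operator :: "nat \<Rightarrow> real \<Rightarrow> (configuration \<Rightarrow> ennreal) \<Rightarrow> configuration \<Rightarrow> ennreal" where
  "arw_operator n lam g \<eta> = (\<integral>\<^sup>+\<eta>'. g \<eta>' \<partial>measure_pmf (arw_step n lam \<eta>))"

lemma arw_operator_le_const:
  "(\<And>\<eta>. g \<eta> \<le> C) \<Longrightarrow> arw_operator n lam g \<eta> \<le> C"
  unfolding arw_operator_def
  using nn_integral_mono[of "measure_pmf (arw_step n lam \<eta>)" g "\<lambda>_. C"]
  by (simp add: measure_pmf.emeasure_space_1)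

lemma arw_operator_funpow_le_1:
  "(arw_operator n lam ^^ t) (indicator S) \<eta> \<le> 1"
  by (induction t arbitrary: \<eta>) (auto intro: arw_operator_le_const simp: indicator_def)

lemma arw_operator_unstable:
  assumes "\<not> stable n \<eta>"
  shows "arw_operator n lam g \<eta> =
    (\<integral>\<^sup>+p. (\<integral>\<^sup>+a. g (perform n (fst p) a \<eta>) \<partial>measure_pmf (action_pmf lam))
      \<partial>measure_pmf (pmf_of_set (active_particles n \<eta>)))"
  using assms
  by (simp add: arw_operator_def arw_step_def nn_integral_bind_pmf case_prod_beta nn_integral_return_pmf)

text \<open>A union bound over the final set of sleepers, whose size is the conserved number of
  particles. At an unstable configuration \<open>absorbed_Suc\<close> gives the same bound for every
  site that the random choice may topple, so the bound survives averaging over this choice.\<close>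

lemma arw_operator_funpow_le_sum_absorbed:
  assumes "lam > 0"
  shows "(arw_operator n lam ^^ t) (indicator {\<eta>. stable n \<eta>}) \<eta>
    \<le> ennreal (\<Sum>A | A \<subseteq> {..<n} \<and> card A = particles n \<eta>. absorbed A n lam t (wake A \<eta>))"
proof -
  have nonneg: "0 \<le> (\<Sum>A | A \<subseteq> {..<n} \<and> card A = N. absorbed A n lam t (wake A \<eta>))" for N t \<eta>
    using assms by (intro sum_nonneg absorbed_nonneg)
  have stable: "(arw_operator n lam ^^ t) (indicator {\<eta>. stable n \<eta>}) \<eta>
    \<le> ennreal (\<Sum>A | A \<subseteq> {..<n} \<and> card A = particles n \<eta>. absorbed A n lam t (wake A \<eta>))"
    if st: "stable n \<eta>" for t \<eta>
  proof -
    \<comment> \<open>The summand of this set alone is 1, since waking off the set of sleepers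
      changes nothing on the cycle.\<close>
    define B where "B = {x. x < n \<and> \<eta> x = Sleepy}"
    have mass: "mass (\<eta> x) = of_bool (x \<in> B)" if "x < n" for x
      using st that by (cases "\<eta> x") (auto simp: B_def stable_def)
    have "particles n \<eta> = (\<Sum>x<n. of_bool (x \<in> B))"
      unfolding particles_def using mass by (intro sum.cong) auto
    also have "\<dots> = card ({..<n} \<inter> B)"
      by (simp add: Int_def)
    also have "{..<n} \<inter> B = B"
      by (auto simp: B_def)
    finally have B: "B \<in> {A. A \<subseteq> {..<n} \<and> card A = particles n \<eta>}"
      by (auto simp: B_def)
    have "stable n (wake B \<eta>)"
      using st by (auto simp: stable_def wake_def B_def)
    then have "1 = absorbed B n lam t (wake B \<eta>)"
      by (simp add: absorbed_stable)
    also have "\<dots> \<le> (\<Sum>A | A \<subseteq> {..<n} \<and> card A = particles n \<eta>. absorbed A n lam t (wake A \<eta>))"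
      using B assms by (intro member_le_sum absorbed_nonneg) (auto intro: finite_subset[OF _ finite_Pow_iff[THEN iffD2]])
    finally have "1 \<le> ennreal (\<Sum>A | A \<subseteq> {..<n} \<and> card A = particles n \<eta>. absorbed A n lam t (wake A \<eta>))"
      by simp
    then show ?thesis
      using arw_operator_funpow_le_1 by (rule order_trans[rotated])
  qed
  show ?thesis
  proof (induction t arbitrary: \<eta>)
    case 0
    then show ?case
      using stable[of \<eta> 0] by (cases "stable n \<eta>") auto
  next
    case (Suc t)
    show ?case
    proof (cases "stable n \<eta>")
      case True
      then show ?thesis by (rule stable)
    next
      case False
      let ?C = "ennreal (\<Sum>A | A \<subseteq> {..<n} \<and> card A = particles n \<eta>. absorbed A n lam (Suc t) (wake A \<eta>))"
      let ?g = "(arw_operator n lam ^^ t) (indicator {\<eta>. stable n \<eta>})"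
      have inner: "(\<integral>\<^sup>+a. ?g (perform n x a \<eta>) \<partial>measure_pmf (action_pmf lam)) \<le> ?C"
        if x: "x < n" "num_active (\<eta> x) > 0" for x
      proof -
        have "?g (perform n x a \<eta>) \<le> ennreal (\<Sum>A | A \<subseteq> {..<n} \<and> card A = particles n \<eta>.
             absorbed A n lam t (perform_on A n x a (wake A \<eta>)))" for a
          using Suc.IH[of "perform n x a \<eta>"] particles_perform_on[of x n \<eta> UNIV a] x wake_perform[of \<eta> x]
          by (simp add: perform_eq_perform_on)
        then have "(\<integral>\<^sup>+a. ?g (perform n x a \<eta>) \<partial>measure_pmf (action_pmf lam))
          \<le> (\<integral>\<^sup>+a. ennreal (\<Sum>A | A \<subseteq> {..<n} \<and> card A = particles n \<eta>.
             absorbed A n lam t (perform_on A n x a (wake A \<eta>))) \<partial>measure_pmf (action_pmf lam))"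
          by (intro nn_integral_mono) auto
        also have "\<dots> = ennreal (action_mean lam (\<lambda>a. \<Sum>A | A \<subseteq> {..<n} \<and> card A = particles n \<eta>.
             absorbed A n lam t (perform_on A n x a (wake A \<eta>))))"
          using assms by (intro nn_integral_action_pmf sum_nonneg absorbed_nonneg)
        also have "\<dots> = ?C"
          unfolding action_mean_sum using x num_active_wake[of \<eta> x]
          by (intro arg_cong[where f = ennreal] sum.cong absorbed_Suc[symmetric]) auto
        finally show ?thesis .
      qed
      have ne: "active_particles n \<eta> \<noteq> {}"
        using False by (simp add: active_particles_eq_empty_iff)
      have "arw_operator n lam ?g \<eta>
        \<le> (\<integral>\<^sup>+p. ?C \<partial>measure_pmf (pmf_of_set (active_particles n \<eta>)))"
        unfolding arw_operator_unstable[OF False]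
        using ne by (intro nn_integral_mono_AE)
          (auto simp: AE_measure_pmf_iff active_particles_def intro!: inner)
      also have "\<dots> = ?C"
        by (simp add: measure_pmf.emeasure_space_1)
      finally show ?thesis
        by simp
    qed
  qed
qed

section \<open>A fixed final set of sleepers\<close>

text \<open>
  A particle starting at \<open>xs ! Suc j\<close> falls asleep there before reaching \<open>xs ! j\<close> with odds \<open>2 * lam * g\<close>,
  where \<open>g\<close> is the distance of the two sites. The potential below is therefore the scale function of
  the birth-death chain with these odds.
\<close>

fun gap_weight :: "real \<Rightarrow> nat list \<Rightarrow> nat \<Rightarrow> real" where
  "gap_weight lam xs 0 = 1"
| "gap_weight lam xs (Suc j) = gap_weight lam xs j / (2 * lam * (real (xs ! Suc j) - real (xs ! j)))"

definition potential :: "real \<Rightarrow> nat list \<Rightarrow> nat \<Rightarrow> real" where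
  "potential lam xs k = (\<Sum>j<k. gap_weight lam xs j)"

lemma gap_weight_pos:
  assumes "lam > 0" and "sorted_wrt (<) xs"
  shows "j < length xs \<Longrightarrow> gap_weight lam xs j > 0"
proof (induction j)
  case (Suc j)
  then have "xs ! j < xs ! Suc j"
    using assms(2) by (simp add: sorted_wrt_nth_less)
  then show ?case
    using Suc assms(1) by simp
qed simp

section \<open>Sleepers confined to a prefix of the final set\<close>

lemma perform_on_Sleepy:
  assumes "perform_on A n x a \<eta> w = Sleepy" and "num_active (\<eta> x) > 0"
  shows "\<eta> w = Sleepy \<or> (w = x \<and> a = Try_sleep \<and> x \<in> A \<and> num_active (\<eta> x) = 1)"
  using assms by (cases "\<eta> w"; cases "\<eta> x"; cases a)
    (auto simp: perform_on_apply Let_def split: if_splits)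

lemma particles_le_card:
  assumes "\<And>x. x < n \<Longrightarrow> mass (\<eta> x) \<le> of_bool (x \<in> B)" and "finite B"
  shows "particles n \<eta> \<le> card B"
proof -
  have "particles n \<eta> \<le> (\<Sum>x<n. of_bool (x \<in> B))"
    unfolding particles_def using assms by (intro sum_mono) auto
  also have "\<dots> = card ({..<n} \<inter> B)"
    by (simp add: Int_def)
  also have "\<dots> \<le> card B"
    using assms(2) by (intro card_mono) auto
  finally show ?thesis .
qed

lemma left_neighbour: "0 < y \<Longrightarrow> y < n \<Longrightarrow> (y + n - 1) mod n = y - (1 :: nat)"
  by (cases y) auto

text \<open>
  In the second claim there is a particle at distance \<open>d\<close> to the left of the hole \<open>xs ! Suc k\<close>. It wakes
  the sleeper at \<open>xs ! k\<close> before it is back at the hole with probability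
  \<open>d / (xs ! Suc k - xs ! k)\<close>, hence the linear interpolation between \<open>f (Suc k)\<close> and
  \<open>f k = f (Suc k) - a k\<close>. The term \<open>t\<close> pays for the restarts at \<open>k = 0\<close>.
\<close>

lemma absorbed_le_potential:
  fixes xs :: "nat list" and t k d :: nat
  assumes lam: "lam > 0" and sorted: "sorted_wrt (<) xs" and xs: "set xs \<subseteq> {..<n}"
  defines "V \<equiv> absorbed (set xs) n lam" and "a \<equiv> gap_weight lam xs" and "f \<equiv> potential lam xs"
    and "N \<equiv> length xs"
  shows "\<lbrakk>k \<le> N; particles n \<eta> = N; \<forall>x. \<eta> x = Sleepy \<longrightarrow> x \<in> set (take k xs)\<rbrakk>
       \<Longrightarrow> f N * V t \<eta> \<le> f k + real t"
    and "\<lbrakk>Suc k < N; particles n \<eta> = N; \<forall>x. \<eta> x = Sleepy \<longrightarrow> x \<in> set (take (Suc k) xs);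
        d \<le> xs ! Suc k - xs ! k; num_active (\<eta> (xs ! Suc k - d)) > 0\<rbrakk>
       \<Longrightarrow> f N * V t \<eta> \<le> f (Suc k) - real d / real (xs ! Suc k - xs ! k) * a k + real t"
proof (induction t arbitrary: k \<eta> d)
  have dist: "distinct xs"
    using sorted by (simp add: strict_sorted_iff)
  have apos: "a j > 0" if "j < N" for j
    using gap_weight_pos[OF lam sorted] that by (simp add: a_def N_def)
  have f_Suc: "f (Suc k) = f k + a k" for k
    by (simp add: f_def potential_def a_def)
  have f_nonneg: "f k \<ge> 0" if "k \<le> N" for k
    unfolding f_def potential_def using apos that by (intro sum_nonneg) (auto simp: a_def less_imp_le)
  have lt: "xs ! i < xs ! j" if "i < j" "j < N" for i j
    using sorted_wrt_nth_less[OF sorted] that by (simp add: N_def)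
  have lt_n: "xs ! j < n" if "j < N" for j
    using xs that nth_mem[of j xs] by (auto simp: N_def simp del: nth_mem)
  \<comment> \<open>All \<open>N\<close> particles then sleep on the first \<open>k\<close> sites,
    one per site.\<close>
  have stable_full: "k = N" if "k \<le> N" "particles n \<eta> = N" "\<forall>x. \<eta> x = Sleepy \<longrightarrow> x \<in> set (take k xs)"
    "stable n \<eta>" for k \<eta>
  proof -
    have "mass (\<eta> x) \<le> of_bool (x \<in> set (take k xs))" if "x < n" for x
      using \<open>stable n \<eta>\<close> \<open>\<forall>x. \<eta> x = Sleepy \<longrightarrow> _ x\<close> that
      by (cases "\<eta> x") (auto simp: stable_def)
    then have "particles n \<eta> \<le> card (set (take k xs))"
      by (rule particles_le_card) auto
    also have "\<dots> \<le> k"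
      by (rule order_trans[OF card_length]) simp
    finally show ?thesis
      using that by simp
  qed
  have f_gap: "f (Suc k) - real d / real (xs ! Suc k - xs ! k) * a k \<ge> 0"
    if "Suc k < N" "d \<le> xs ! Suc k - xs ! k" for k d :: nat
  proof -
    have "real d / real (xs ! Suc k - xs ! k) \<le> 1"
      using that lt[of k "Suc k"] by (simp add: divide_simps)
    then have "real d / real (xs ! Suc k - xs ! k) * a k \<le> 1 * a k"
      using apos[of k] that by (intro mult_right_mono) auto
    then show ?thesis
      using f_nonneg[of k] that f_Suc[of k] by simp
  qed
  {
    case 0
    {
      case 1
      then show ?case
        using stable_full[of k \<eta>] f_nonneg[of k] by (cases "stable n \<eta>") (auto simp: V_def)
    next
      case 2
      then have "\<not> stable n \<eta>"
        using lt_n[of "Suc k"] by (auto simp: stable_def intro!: exI[of _ "xs ! Suc k - d"])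
      then show ?case
        using f_gap[of k d] 2 by (simp add: V_def)
    }
  next
    case (Suc t)
    note IH1 = Suc(1) and IH2 = Suc(2)
    have mean_le: "f N * action_mean lam \<phi> \<le> action_mean lam \<psi>"
      if "\<And>b. f N * \<phi> b \<le> \<psi> b" for \<phi> \<psi>
    proof -
      have "f N * action_mean lam \<phi> = action_mean lam (\<lambda>b. f N * \<phi> b)"
      proof -
        define p q where "p = 1 / (2 * (1 + lam))" and "q = lam / (1 + lam)"
        show ?thesis
          unfolding action_mean_def p_def[symmetric] q_def[symmetric] by (simp add: algebra_simps)
      qed
      also have "\<dots> \<le> action_mean lam \<psi>"
        unfolding action_mean_def using lam that by (intro add_mono mult_left_mono) auto
      finally show ?thesis .
    qed
    have V_Suc: "V (Suc t) \<eta> = action_mean lam (\<lambda>b. V t (perform_on (set xs) n x b \<eta>))"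
      if "x < n" "num_active (\<eta> x) > 0" for x \<eta>
      unfolding V_def using that by (rule absorbed_Suc)
    \<comment> \<open>The first claim is isolated because the second one needs it, at the same time
      \<open>Suc t\<close>, for the two extreme values of \<open>d\<close>.\<close>
    have claim1: "f N * V (Suc t) \<eta> \<le> f k + Suc t"
      if k: "k \<le> N" and part: "particles n \<eta> = N"
        and sl: "\<forall>x. \<eta> x = Sleepy \<longrightarrow> x \<in> set (take k xs)" for k \<eta>
    proof -
      \<comment> \<open>First comes any toppling that cannot put a sleeper outside the prefix. When
        none is left, every active particle stands alone on a site of \<open>xs\<close> beyond the
        prefix.\<close>
      consider "stable n \<eta>"
        | z where "z < n" "num_active (\<eta> z) > 0"
            "z \<notin> set xs \<or> num_active (\<eta> z) \<noteq> 1 \<or> z \<in> set (take k xs)"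
        | "\<not> stable n \<eta>" "\<And>z. z < n \<Longrightarrow> num_active (\<eta> z) > 0 \<Longrightarrow>
            z \<in> set xs \<and> num_active (\<eta> z) = 1 \<and> z \<notin> set (take k xs)"
        by blast
      then show ?thesis
      proof cases
        case 1
        then show ?thesis
          using stable_full[OF k part sl] by (simp add: V_def absorbed_stable)
      next
        case (2 z)
        have "f N * V t (perform_on (set xs) n z b \<eta>) \<le> f k + t" for b
        proof (rule IH1[OF k])
          show "particles n (perform_on (set xs) n z b \<eta>) = N"
            using 2 part by (simp add: particles_perform_on)
          show "\<forall>x. perform_on (set xs) n z b \<eta> x = Sleepy \<longrightarrow> x \<in> set (take k xs)"
            using 2 sl by (auto dest!: perform_on_Sleepy)
        qed
        then have "f N * V (Suc t) \<eta> \<le> action_mean lam (\<lambda>b. f k + t)"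
          unfolding V_Suc[where x = z and \<eta> = \<eta>, OF 2(1,2)] by (rule mean_le)
        also have "\<dots> \<le> f k + Suc t"
          using lam by (intro action_mean_le_const) auto
        finally show ?thesis .
      next
        case 3
        obtain z where z: "z < n" "num_active (\<eta> z) > 0"
          using 3(1) by (auto simp: stable_def)
        have kN: "k < N"
          using 3(2)[OF z] k by (cases "k = N") (auto simp: N_def)
        \<comment> \<open>With at most one particle per site of \<open>xs\<close> and none
          elsewhere, the total \<open>N\<close> forces every site of \<open>xs\<close> to be
          occupied, in particular \<open>xs ! k\<close>.\<close>
        have mass_le: "mass (\<eta> x) \<le> of_bool (x \<in> set xs)" if "x < n" for x
          using 3(2)[OF that] sl set_take_subset[of k xs] by (cases "\<eta> x") auto
        have "mass (\<eta> (xs ! k)) = 1"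
        proof (rule ccontr)
          assume ne: "mass (\<eta> (xs ! k)) \<noteq> 1"
          have "particles n \<eta> \<le> card (set xs - {xs ! k})"
          proof (rule particles_le_card)
            fix x assume "x < n"
            then show "mass (\<eta> x) \<le> of_bool (x \<in> set xs - {xs ! k})"
              using mass_le[of x] ne by (cases "x \<in> set xs"; cases "x = xs ! k") auto
          qed simp
          also have "\<dots> < N"
            using kN distinct_card[OF dist] by (simp add: N_def)
          finally show False
            using part by simp
        qed
        moreover have "xs ! k \<notin> set (take k xs)"
          using dist kN by (auto simp: in_set_conv_nth nth_eq_iff_index_eq N_def)
        ultimately have act: "\<eta> (xs ! k) = Active 1"
          using sl by (cases "\<eta> (xs ! k)") auto
        have k_n: "xs ! k < n"
          using lt_n kN by simp
        have part': "particles n (perform_on (set xs) n (xs ! k) b \<eta>) = N" for b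
          using part act k_n by (simp add: particles_perform_on)
        have sl': "\<forall>x. perform_on (set xs) n (xs ! k) b \<eta> x = Sleepy \<longrightarrow> x \<in> set (take k xs)"
          if "b \<noteq> Try_sleep" for b
          using sl that act by (auto dest!: perform_on_Sleepy)
        have other: "f N * V t (perform_on (set xs) n (xs ! k) b \<eta>) \<le> f k + t" if "b \<noteq> Try_sleep" for b
          using k part' sl'[OF that] by (rule IH1)
        have sleep: "f N * V t (perform_on (set xs) n (xs ! k) Try_sleep \<eta>) \<le> f (Suc k) + t"
        proof (rule IH1[OF _ part'])
          show "Suc k \<le> N"
            using kN by simp
          have "set (take (Suc k) xs) = insert (xs ! k) (set (take k xs))"
            using kN by (simp add: take_Suc_conv_app_nth N_def)
          then show "\<forall>x. perform_on (set xs) n (xs ! k) Try_sleep \<eta> x = Sleepy \<longrightarrow> x \<in> set (take (Suc k) xs)"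
            using sl act by (auto dest!: perform_on_Sleepy)
        qed
        have step: "V (Suc t) \<eta> = action_mean lam (\<lambda>b. V t (perform_on (set xs) n (xs ! k) b \<eta>))"
          using k_n act by (intro V_Suc) auto
        show ?thesis
        proof (cases k)
          case 0
          \<comment> \<open>There is no sleeper to lose here. Falling asleep raises the potential by
            \<open>a 0 = 1\<close>, which the elapsed time step pays for.\<close>
          have "f N * V (Suc t) \<eta> \<le> action_mean lam (\<lambda>b. f (Suc k) + t)"
            unfolding step
          proof (rule mean_le)
            fix b
            show "f N * V t (perform_on (set xs) n (xs ! k) b \<eta>) \<le> f (Suc k) + t"
              using sleep other[of b] f_Suc[of k] apos[OF kN] by (cases "b = Try_sleep") auto
          qed
          also have "\<dots> \<le> f (Suc k) + t"
            using lam by (intro action_mean_le_const) auto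
          also have "\<dots> = f k + Suc t"
            using 0 by (simp add: f_Suc a_def)
          finally show ?thesis .
        next
          case (Suc j)
          define g where "g = xs ! Suc j - xs ! j"
          have g: "g > 0" "xs ! j < xs ! Suc j" "real g = real (xs ! Suc j) - real (xs ! j)"
            using lt[of j "Suc j"] Suc kN by (auto simp: g_def)
          have left: "f N * V t (perform_on (set xs) n (xs ! k) Jump_left \<eta>) \<le> f (Suc j) - 1 / g * a j + t"
          proof -
            have "num_active (perform_on (set xs) n (xs ! k) Jump_left \<eta> (xs ! Suc j - 1)) > 0"
              using left_neighbour[of "xs ! k" n] g k_n Suc
              by (simp add: perform_on_apply Let_def num_active_add_active)
            then show ?thesis
              using IH2[of j _ 1] kN Suc part' sl'[of Jump_left] g by (simp add: g_def)
          qed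
          define \<psi> where "\<psi> b = (case b of Try_sleep \<Rightarrow> f (Suc k) + t | Jump_right \<Rightarrow> f k + t
              | Jump_left \<Rightarrow> f (Suc j) - 1 / g * a j + t)" for b
          have "f N * V (Suc t) \<eta> \<le> action_mean lam \<psi>"
            unfolding step
          proof (rule mean_le)
            fix b
            show "f N * V t (perform_on (set xs) n (xs ! k) b \<eta>) \<le> \<psi> b"
              using sleep left other by (cases b) (auto simp: \<psi>_def)
          qed
          \<comment> \<open>This balance dictates \<open>gap_weight\<close>: the gain
            \<open>a k\<close> at rate \<open>lam\<close> cancels the loss \<open>a j / g\<close> at
            rate 1/2.\<close>
          also have "action_mean lam \<psi> = f k + t"
          proof -
            have ak: "a k = a j / (2 * lam * g)"
              using Suc g by (simp add: a_def)
            have "action_mean lam \<psi> = 1 / (2 * (1 + lam)) * (f k - 1 / g * a j + t + (f k + t))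
                + lam / (1 + lam) * (f k + a j / (2 * lam * g) + t)"
              by (simp only: action_mean_def \<psi>_def action.case f_Suc[of k] ak Suc[symmetric])
            also have "\<dots> = f k + t"
              using lam g(1) by (simp add: divide_simps) (simp add: algebra_simps)
            finally show ?thesis .
          qed
          finally show ?thesis by simp
        qed
      qed
    qed
    {
      case 1
      then show ?case by (rule claim1)
    next
      case 2
      define g where "g = xs ! Suc k - xs ! k"
      have g: "g > 0" "xs ! k < xs ! Suc k"
        using lt[of k "Suc k"] 2 by (auto simp: g_def)
      consider "d = 0" | "d = g" | "0 < d" "d < g"
        using 2 by (fold g_def) linarith
      then show ?case
      proof cases
        case d: 1
        then show ?thesis
          using claim1[of "Suc k" \<eta>] 2 by simp
      next
        case d: 2
        \<comment> \<open>The active particle now stands on \<open>xs ! k\<close>, so only the first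
          \<open>k\<close> sites can hold sleepers.\<close>
        then have "num_active (\<eta> (xs ! k)) > 0"
          using 2(5) g by (simp add: g_def)
        moreover have "set (take (Suc k) xs) = insert (xs ! k) (set (take k xs))"
          using 2(1) by (simp add: take_Suc_conv_app_nth N_def)
        ultimately have "\<forall>x. \<eta> x = Sleepy \<longrightarrow> x \<in> set (take k xs)"
          using 2(3) by auto
        then show ?thesis
          using claim1[of k \<eta>] 2 d g f_Suc[of k] by (simp add: g_def[symmetric])
      next
        case d: 3
        define y where "y = xs ! Suc k - d"
        have y: "xs ! k < y" "y < xs ! Suc k" "y < n" "num_active (\<eta> y) > 0"
          using d 2 g lt_n[of "Suc k"] by (auto simp: y_def g_def)
        \<comment> \<open>Strictly between consecutive sites of \<open>xs\<close> sleep instructions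
          are ignored. The particle performs a lazy symmetric walk, for which the interpolation,
          being linear in \<open>d\<close>, is harmonic.\<close>
        have "y \<noteq> xs ! j" if "j < N" for j
          using y lt[of j k] lt[of "Suc k" j] 2(1) that
          by (cases "j < k"; cases "j = k"; cases "j = Suc k") auto
        then have y_notin: "y \<notin> set xs"
          by (auto simp: in_set_conv_nth N_def)
        have part': "particles n (perform_on (set xs) n y b \<eta>) = N" for b
          using 2 y by (simp add: particles_perform_on)
        have sl': "\<forall>x. perform_on (set xs) n y b \<eta> x = Sleepy \<longrightarrow> x \<in> set (take (Suc k) xs)" for b
          using 2(3) y_notin y by (auto dest!: perform_on_Sleepy)
        have bound: "f N * V t (perform_on (set xs) n y b \<eta>) \<le> f (Suc k) - e / g * a k + t"
          if "e \<le> g" "num_active (perform_on (set xs) n y b \<eta> (xs ! Suc k - e)) > 0" for b e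
          using IH2[of k "perform_on (set xs) n y b \<eta>" e] that 2(1) part' sl' by (simp add: g_def)
        have left: "f N * V t (perform_on (set xs) n y Jump_left \<eta>) \<le> f (Suc k) - (d + 1) / g * a k + t"
        proof -
          have "target n y Jump_left = Some (xs ! Suc k - (d + 1))"
            using left_neighbour[of y n] y by (simp add: y_def)
          then have "num_active (perform_on (set xs) n y Jump_left \<eta> (xs ! Suc k - (d + 1))) > 0"
            unfolding perform_on_apply Let_def by (simp add: num_active_add_active)
          then show ?thesis
            using bound[of "d + 1" Jump_left] d by (simp add: add.commute)
        qed
        have right: "f N * V t (perform_on (set xs) n y Jump_right \<eta>) \<le> f (Suc k) - (d - 1) / g * a k + t"
        proof -
          have "Suc y = xs ! Suc k - (d - 1)" "Suc y < n"
            using d y lt_n[of "Suc k"] 2(1) by (auto simp: y_def)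
          then have "num_active (perform_on (set xs) n y Jump_right \<eta> (xs ! Suc k - (d - 1))) > 0"
            by (simp add: perform_on_apply Let_def num_active_add_active)
          then show ?thesis
            using bound[of "d - 1" Jump_right] d by simp
        qed
        have sleep: "f N * V t (perform_on (set xs) n y Try_sleep \<eta>) \<le> f (Suc k) - d / g * a k + t"
          using bound[of d Try_sleep] d y y_notin by (simp add: perform_on_def y_def)
        define \<psi> where "\<psi> b = (case b of Try_sleep \<Rightarrow> f (Suc k) - d / g * a k + t
            | Jump_right \<Rightarrow> f (Suc k) - (real d - 1) / g * a k + t
            | Jump_left \<Rightarrow> f (Suc k) - (real d + 1) / g * a k + t)" for b
        have "f N * V (Suc t) \<eta> \<le> action_mean lam \<psi>"
          unfolding V_Suc[where x = y and \<eta> = \<eta>, OF y(3,4)]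
        proof (rule mean_le)
          fix b
          show "f N * V t (perform_on (set xs) n y b \<eta>) \<le> \<psi> b"
            using sleep left right d by (cases b) (auto simp: \<psi>_def of_nat_diff add.commute)
        qed
        also have "action_mean lam \<psi> = f (Suc k) - d / g * a k + t"
          using lam g(1) unfolding action_mean_def \<psi>_def action.case
          by (simp add: divide_simps) (simp add: algebra_simps)
        finally show ?thesis
          by (simp add: g_def)
      qed
    }
  }
qed

text \<open>The weight times \<open>(2 * lam) ^ j\<close> is the reciprocal of the product of the
  first \<open>j\<close> gaps. Each gap \<open>g\<close> is at most \<open>exp g\<close>, and these
  gaps add up to at most \<open>xs ! j\<close>.\<close>

lemma gap_weight_lower:
  assumes "lam > 0" and "sorted_wrt (<) xs"
  shows "j < length xs \<Longrightarrow> 1 \<le> gap_weight lam xs j * ((2 * lam) ^ j * exp (real (xs ! j)))"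
proof (induction j)
  case 0
  then show ?case by simp
next
  case (Suc j)
  define g where "g = real (xs ! Suc j) - real (xs ! j)"
  have g: "g > 0"
    using Suc.prems assms(2) by (simp add: g_def sorted_wrt_nth_less)
  have "1 \<le> gap_weight lam xs j * ((2 * lam) ^ j * exp (real (xs ! j)))"
    using Suc by simp
  also have "\<dots> \<le> gap_weight lam xs j * ((2 * lam) ^ j * exp (real (xs ! j))) * (exp g / g)"
  proof -
    have "1 \<le> exp g / g"
      using g exp_ge_add_one_self[of g] by (simp add: le_divide_eq del: exp_ge_add_one_self)
    then show ?thesis
      using mult_left_mono[of 1 "exp g / g" "gap_weight lam xs j * ((2 * lam) ^ j * exp (real (xs ! j)))"]
        gap_weight_pos[OF assms, of j] Suc.prems assms(1) by simp
  qed
  also have "\<dots> = gap_weight lam xs (Suc j) * ((2 * lam) ^ Suc j * exp (real (xs ! j) + g))"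
    using assms(1) g by (simp add: exp_add divide_simps flip: g_def)
  also have "real (xs ! j) + g = xs ! Suc j"
    by (simp add: g_def)
  finally show ?case .
qed

text \<open>Without sleepers the potential starts at 0, so \<open>absorbed_le_potential\<close>
  leaves only the time term \<open>t\<close>. The total potential is at least its last weight, of
  index \<open>m\<close> as there are \<open>Suc m\<close> sites.\<close>

lemma absorbed_le_pow:
  assumes lam: "lam > 0" and A: "A \<subseteq> {..<n}" "card A = Suc m" and part: "particles n \<eta> = Suc m"
    and awake: "\<And>x. \<eta> x \<noteq> Sleepy"
  shows "absorbed A n lam t \<eta> \<le> t * (2 * lam) ^ m * exp n"
proof -
  define xs where "xs = sorted_list_of_set A"
  have fin: "finite A"
    using A(1) by (rule finite_subset) simp
  have xs: "sorted_wrt (<) xs" "set xs = A" "length xs = Suc m"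
    using fin A(2) by (auto simp: xs_def)
  have V: "absorbed A n lam t \<eta> \<ge> 0"
    using lam by (rule absorbed_nonneg)
  have a: "gap_weight lam xs m > 0"
    using lam xs by (intro gap_weight_pos) auto
  have "xs ! m < n"
    using A(1) xs nth_mem[of m xs] by auto
  have "gap_weight lam xs m \<le> potential lam xs (Suc m)"
    unfolding potential_def
    using gap_weight_pos[OF lam xs(1)] xs(3) by (intro member_le_sum) (auto simp: less_imp_le)
  then have "gap_weight lam xs m * absorbed A n lam t \<eta> \<le> potential lam xs (Suc m) * absorbed A n lam t \<eta>"
    using V by (rule mult_right_mono)
  also have "\<dots> \<le> t"
    using absorbed_le_potential(1)[of lam xs n 0 \<eta> t] lam xs A part awake
    by (simp add: potential_def)
  finally have le: "gap_weight lam xs m * absorbed A n lam t \<eta> \<le> t" .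
  have "absorbed A n lam t \<eta> \<le> absorbed A n lam t \<eta> * (gap_weight lam xs m * ((2 * lam) ^ m * exp (real (xs ! m))))"
    using mult_left_mono[OF gap_weight_lower[OF lam xs(1), of m] V] xs(3) by simp
  also have "\<dots> = gap_weight lam xs m * absorbed A n lam t \<eta> * ((2 * lam) ^ m * exp (real (xs ! m)))"
    by simp
  also have "\<dots> \<le> t * ((2 * lam) ^ m * exp n)"
    using le lam V a \<open>xs ! m < n\<close> by (intro mult_mono) auto
  finally show ?thesis by simp
qed

section \<open>The stabilisation time\<close>

text \<open>
  The exponent \<open>s\<close> interpolates with the trivial bound 1, so that a single exponential moment of the
  number of particles suffices later on.
\<close>

lemma arw_operator_funpow_le_powr:
  assumes lam: "0 < lam" "lam \<le> 1/2" and awake: "\<And>x. \<eta> x \<noteq> Sleepy" and s: "0 \<le> s" "s \<le> 1"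
  shows "(arw_operator n lam ^^ t) (indicator {\<eta>. stable n \<eta>}) \<eta>
    \<le> ennreal ((Suc t * (2 * exp 1) ^ n / (2 * lam)) powr s * ((2 * lam) powr s) ^ particles n \<eta>)"
proof -
  let ?U = "(arw_operator n lam ^^ t) (indicator {\<eta>. stable n \<eta>}) \<eta>"
  \<comment> \<open>The factor \<open>2 ^ n\<close> bounds the number of sets and
    \<open>exp n\<close> the product of gaps; dividing by \<open>2 * lam\<close> raises the exponent
    \<open>m\<close> to the number of particles. \<open>Suc t\<close> keeps \<open>B\<close> at
    least 1 at time 0.\<close>
  define B where "B = Suc t * (2 * exp 1) ^ n / (2 * lam)"
  define X where "X = B * (2 * lam) ^ particles n \<eta>"
  have B: "B \<ge> 1"
  proof -
    have "1 * 1 \<le> real (Suc t) * (2 * exp 1) ^ n"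
      using exp_ge_add_one_self[of 1] by (intro mult_mono one_le_power) auto
    then show ?thesis
      using lam by (simp add: B_def field_simps)
  qed
  have X: "X > 0"
    using B lam by (simp add: X_def)
  have powr: "X powr s = B powr s * ((2 * lam) powr s) ^ particles n \<eta>"
  proof -
    define y where "y = 2 * lam"
    have "(y ^ k) powr s = (y powr s) ^ k" for k
      by (induction k) (use lam in \<open>auto simp: powr_mult y_def\<close>)
    moreover have "X powr s = B powr s * (y ^ particles n \<eta>) powr s"
      unfolding X_def y_def by (rule powr_mult)
    ultimately show ?thesis
      by (simp add: y_def)
  qed
  have wake: "wake A \<eta> = \<eta>" for A
    using awake by (auto simp: wake_def)
  \<comment> \<open>The trivial bound 1 settles \<open>X \<ge> 1\<close>, which covers the case of
    no particles. For smaller \<open>X\<close>, the bound \<open>X\<close> is at most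
    \<open>X powr s\<close>.\<close>
  have "?U \<le> ennreal (X powr s)"
  proof (cases "X \<ge> 1")
    case True
    then have "ennreal 1 \<le> ennreal (X powr s)"
      using s by (intro ennreal_leI ge_one_powr_ge_zero)
    then show ?thesis
      using arw_operator_funpow_le_1[of t n lam "{\<eta>. stable n \<eta>}" \<eta>] by (auto intro: order_trans)
  next
    case False
    then obtain m where m: "particles n \<eta> = Suc m"
      using B by (cases "particles n \<eta>") (auto simp: X_def)
    have "?U \<le> ennreal (\<Sum>A | A \<subseteq> {..<n} \<and> card A = particles n \<eta>. absorbed A n lam t (wake A \<eta>))"
      using lam(1) by (rule arw_operator_funpow_le_sum_absorbed)
    also have "\<dots> \<le> ennreal (X powr s)"
    proof (rule ennreal_leI)
      have "(\<Sum>A | A \<subseteq> {..<n} \<and> card A = particles n \<eta>. absorbed A n lam t (wake A \<eta>))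
          \<le> (\<Sum>A | A \<subseteq> {..<n} \<and> card A = particles n \<eta>. t * (2 * lam) ^ m * exp n)"
        unfolding wake using lam m awake by (intro sum_mono absorbed_le_pow) auto
      also have "\<dots> \<le> (\<Sum>A\<in>Pow {..<n}. t * (2 * lam) ^ m * exp n)"
        using lam by (intro sum_mono2) auto
      also have "\<dots> = t * ((2 * exp 1) ^ n * (2 * lam) ^ m)"
        by (simp add: card_Pow power_mult_distrib exp_of_nat_mult[of n 1, simplified])
      also have "\<dots> \<le> Suc t * ((2 * exp 1) ^ n * (2 * lam) ^ m)"
        using lam by (intro mult_right_mono) auto
      also have "\<dots> = X"
        using lam by (simp add: X_def B_def m)
      also have "X \<le> X powr s"
        using powr_mono'[of s 1 X] s X False by simp
      finally show "(\<Sum>A | A \<subseteq> {..<n} \<and> card A = particles n \<eta>. absorbed A n lam t (wake A \<eta>)) \<le> X powr s" .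
    qed
    finally show ?thesis .
  qed
  then show ?thesis
    unfolding powr by (simp add: B_def)
qed

section \<open>Averaging over the random initial configuration\<close>

lemma expectation_pow_particles:
  assumes "0 \<le> \<mu>" "\<mu> \<le> 1" and "0 \<le> z" "z \<le> 1"
  shows "(\<integral>\<^sup>+\<eta>. ennreal (z ^ particles n \<eta>) \<partial>measure_pmf (arw_initial n \<mu>))
     = ennreal ((1 - \<mu> + \<mu> * z) ^ n)"
proof -
  have "(\<integral>\<^sup>+\<eta>. ennreal (z ^ particles n \<eta>) \<partial>measure_pmf (arw_initial n \<mu>))
      = ennreal (measure_pmf.expectation (arw_initial n \<mu>) (\<lambda>\<eta>. z ^ particles n \<eta>))"
    using assms by (intro nn_integral_eq_integral measure_pmf.integrable_const_bound[where B = 1])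
      (auto simp: power_le_one)
  also have "measure_pmf.expectation (arw_initial n \<mu>) (\<lambda>\<eta>. z ^ particles n \<eta>)
      = measure_pmf.expectation (arw_initial n \<mu>) (\<lambda>\<eta>. \<Prod>x<n. z ^ mass (\<eta> x))"
    by (simp add: particles_def power_sum)
  also have "\<dots> = (\<Prod>x<n. measure_pmf.expectation
      (map_pmf (\<lambda>b. Active (of_bool b)) (bernoulli_pmf \<mu>)) (\<lambda>s. z ^ mass s))"
    unfolding arw_initial_def
    using assms by (intro expectation_prod_Pi_pmf)
      (auto intro!: measure_pmf.integrable_const_bound[where B = 1] simp: power_le_one)
  also have "\<dots> = (1 - \<mu> + \<mu> * z) ^ n"
    using assms by (simp add: algebra_simps)
  finally show ?thesis .
qed

lemma arw_initial_awake: "\<eta> \<in> set_pmf (arw_initial n \<mu>) \<Longrightarrow> \<eta> x \<noteq> Sleepy"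
  by (cases "x < n") (auto simp: arw_initial_def set_Pi_pmf PiE_dflt_def)

text \<open>All particles start active and their number is binomial; its generating function at
  \<open>(2 * lam) powr s\<close> is the last factor.\<close>

lemma prob_stable_at_time:
  assumes lam: "0 < lam" "lam \<le> 1/2" and \<mu>: "0 \<le> \<mu>" "\<mu> \<le> 1" and s: "0 \<le> s" "s \<le> 1"
  shows "measure (ARW n \<mu> lam) {\<xi>. stable n (\<xi> t)}
     \<le> (Suc t * (2 * exp 1) ^ n / (2 * lam)) powr s * (1 - \<mu> + \<mu> * (2 * lam) powr s) ^ n"
proof -
  let ?C = "(Suc t * (2 * exp 1) ^ n / (2 * lam)) powr s" and ?z = "(2 * lam) powr s"
  have z: "?z \<le> 1"
    using lam s powr_mono2[of s "2 * lam" 1] by simp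
  have op: "(\<lambda>g \<eta>. \<integral>\<^sup>+\<eta>'. g \<eta>' \<partial>measure_pmf (arw_step n lam \<eta>)) = arw_operator n lam"
    by (intro ext) (simp add: arw_operator_def)
  have "emeasure (ARW n \<mu> lam) {\<xi>. stable n (\<xi> t)}
      = (\<integral>\<^sup>+\<eta>. (arw_operator n lam ^^ t) (indicator {\<eta>. stable n \<eta>}) \<eta> \<partial>measure_pmf (arw_initial n \<mu>))"
    using emeasure_chain_law_marginal[of "arw_initial n \<mu>" "arw_step n lam" t "{\<eta>. stable n \<eta>}"]
    unfolding op by (simp add: ARW_def)
  also have "\<dots> \<le> (\<integral>\<^sup>+\<eta>. ennreal ?C * ennreal (?z ^ particles n \<eta>) \<partial>measure_pmf (arw_initial n \<mu>))"
    using arw_operator_funpow_le_powr[OF lam _ s] arw_initial_awake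
    by (intro nn_integral_mono_AE) (auto simp: AE_measure_pmf_iff ennreal_mult)
  also have "\<dots> = ennreal (?C * (1 - \<mu> + \<mu> * ?z) ^ n)"
    using \<mu> z by (subst nn_integral_cmult) (auto simp: expectation_pow_particles ennreal_mult)
  finally show ?thesis
    using \<mu> by (simp add: measure_def enn2real_leI)
qed

section \<open>Choice of the constants and union bound over times\<close>

theorem theorem2:
  fixes \<mu> :: real
  assumes "0 < \<mu>" and "\<mu> < 1"
  shows "\<exists>lam0>0. \<exists>c>0. \<forall>lam::real. 0 < lam \<and> lam < lam0 \<longrightarrow>
           (\<forall>\<^sub>F n in sequentially.
              measure (ARW n \<mu> lam)
                {\<xi> \<in> space (ARW n \<mu> lam).
                   ereal_of_enat (total_attempts n \<xi>) < ereal (exp (c * real n))}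
              < exp (- (c * real n)))"
proof -
  \<comment> \<open>The decay rate of the binomial generating function at argument 1/2.\<close>
  define \<delta> where "\<delta> = - ln (1 - \<mu> / 2)"
  have \<delta>: "\<delta> > 0" "1 - \<mu> / 2 = exp (- \<delta>)"
    using assms by (auto simp: \<delta>_def)
  \<comment> \<open>\<open>c\<close> is both the rate in the claim and the interpolation exponent
    \<open>s\<close>. The losses below are at most \<open>4 * c * n\<close>, so
    \<open>8 * c \<le> \<delta>\<close> leaves a decay of \<open>4 * c * n\<close>.\<close>
  define c where "c = min 1 \<delta> / 8"
  have c: "0 < c" "c \<le> 1" "8 * c \<le> \<delta>"
    using \<delta> by (auto simp: c_def)
  \<comment> \<open>Solves \<open>(2 * lam0) powr c = 1/2\<close>; smaller sleep rates only decrease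
    this power.\<close>
  define lam0 :: real where "lam0 = (1/2) powr (1 / c) / 2"
  have lam0: "lam0 > 0" "lam0 \<le> 1/2" "(2 * lam0) powr c = 1/2"
    using c powr_mono2[of "1 / c" "1/2" 1] by (auto simp: lam0_def powr_powr)
  have "\<forall>\<^sub>F n in sequentially. measure (ARW n \<mu> lam)
          {\<xi> \<in> space (ARW n \<mu> lam). ereal_of_enat (total_attempts n \<xi>) < ereal (exp (c * real n))}
        < exp (- (c * real n))" if lam: "0 < lam" "lam < lam0" for lam
  proof -
    \<comment> \<open>This prefactor collects the dependence on \<open>lam\<close>, with 2 coming
      from the number of times. It is absorbed only for large \<open>n\<close>, hence
      \<open>n0\<close>.\<close>
    define K where "K = 2 / lam powr c"
    obtain n0 :: nat where n0: "K < 3 * c * n0"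
      using reals_Archimedean2[of "K / (3 * c)"] c by (auto simp: field_simps)
    have "measure (ARW n \<mu> lam)
          {\<xi> \<in> space (ARW n \<mu> lam). ereal_of_enat (total_attempts n \<xi>) < ereal (exp (c * real n))}
        < exp (- (c * real n))" if n: "n \<ge> n0" for n
    proof -
      interpret prob_space "ARW n \<mu> lam"
        by (rule prob_space_ARW)
      define E where "E = exp (c * real n)"
      \<comment> \<open>Rounding up makes \<open>k < m\<close> cover all integer times below
        \<open>E\<close>.\<close>
      define m where "m = nat \<lceil>E\<rceil>"
      have E: "E \<ge> 1" "m \<le> 2 * E"
      proof -
        show "E \<ge> 1"
          using c by (simp add: E_def)
        then show "m \<le> 2 * E"
          unfolding m_def by linarith
      qed
      have [measurable]: "Measurable.pred (ARW n \<mu> lam) (\<lambda>\<xi>. stable n (\<xi> k))" for k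
        unfolding ARW_def by (rule measurable_compose[OF measurable_chain_component]) simp
      have z: "(2 * lam) powr c \<le> 1/2"
        using powr_mono2[of c "2 * lam" "2 * lam0"] lam lam0 c by simp
      let ?Z = "(2 * E * exp (2 * real n) / (2 * lam)) powr c * exp (- \<delta> * n)"
      have bound: "prob {\<xi>. stable n (\<xi> k)} \<le> ?Z" if k: "k < m" for k
      proof -
        have "prob {\<xi>. stable n (\<xi> k)} \<le> (Suc k * (2 * exp 1) ^ n / (2 * lam)) powr c
            * (1 - \<mu> + \<mu> * (2 * lam) powr c) ^ n"
          using lam lam0 assms c by (intro prob_stable_at_time) auto
        also have "\<dots> \<le> ?Z"
        proof (rule mult_mono)
          have "(2 * exp 1 :: real) ^ n \<le> (exp 2) ^ n"
            using exp_ge_add_one_self[of 1] exp_add[of 1 "1 :: real"]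
            by (intro power_mono) auto
          also have "\<dots> = exp (2 * real n)"
            by (simp add: exp_of_nat2_mult)
          finally have "(2 * exp 1 :: real) ^ n \<le> exp (2 * real n)" .
          moreover have "real (Suc k) \<le> 2 * E"
            using k E by linarith
          ultimately show "(Suc k * (2 * exp 1) ^ n / (2 * lam)) powr c
              \<le> (2 * E * exp (2 * real n) / (2 * lam)) powr c"
            using lam c by (intro powr_mono2 divide_right_mono mult_mono) auto
          have "1 - \<mu> + \<mu> * (2 * lam) powr c \<le> 1 - \<mu> / 2"
            using mult_left_mono[OF z, of \<mu>] assms by linarith
          then have "(1 - \<mu> + \<mu> * (2 * lam) powr c) ^ n \<le> (1 - \<mu> / 2) ^ n"
            using assms by (intro power_mono) auto
          also have "\<dots> = exp (- \<delta> * n)"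
            using exp_of_nat2_mult[of "- \<delta>" n] by (simp add: \<delta>)
          finally show "(1 - \<mu> + \<mu> * (2 * lam) powr c) ^ n \<le> exp (- \<delta> * n)" .
        qed (use assms in auto)
        finally show ?thesis .
      qed
      have "{\<xi> \<in> space (ARW n \<mu> lam). ereal_of_enat (total_attempts n \<xi>) < ereal E}
          \<subseteq> (\<Union>k<m. {\<xi>. stable n (\<xi> k)})"
      proof
        fix \<xi> assume "\<xi> \<in> {\<xi> \<in> space (ARW n \<mu> lam). ereal_of_enat (total_attempts n \<xi>) < ereal E}"
        then obtain k where k: "real k < E" "stable n (\<xi> k)"
          by (auto simp: total_attempts_less_iff)
        moreover have "k < m"
          using k(1) unfolding m_def by linarith
        ultimately show "\<xi> \<in> (\<Union>k<m. {\<xi>. stable n (\<xi> k)})"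
          by auto
      qed
      moreover have sets: "{\<xi>. stable n (\<xi> k)} \<in> events" for k
        using measurable_sets[of "\<lambda>\<xi>. stable n (\<xi> k)" "ARW n \<mu> lam" "count_space UNIV" "{True}"]
        by (simp add: vimage_def)
      ultimately have "prob {\<xi> \<in> space (ARW n \<mu> lam). ereal_of_enat (total_attempts n \<xi>) < ereal E}
          \<le> prob (\<Union>k<m. {\<xi>. stable n (\<xi> k)})"
        by (intro finite_measure_mono) auto
      also have "\<dots> \<le> (\<Sum>k<m. prob {\<xi>. stable n (\<xi> k)})"
        using sets by (intro finite_measure_subadditive_finite) auto
      also have "\<dots> \<le> (\<Sum>k<m. ?Z)"
        using bound by (intro sum_mono) auto
      also have "\<dots> \<le> 2 * E * ?Z"
        using E by (simp add: mult_right_mono)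
      also have "\<dots> = K * exp (c * n + c * (c * n + 2 * n) - \<delta> * n)"
      proof -
        have "(2 * E * exp (2 * real n) / (2 * lam)) powr c = exp (c * n + 2 * n) powr c / lam powr c"
          using lam by (simp add: E_def exp_add powr_divide)
        also have "exp (c * n + 2 * n) powr c = exp (c * (c * n + 2 * n))"
          by (simp add: powr_def)
        finally have "(2 * E * exp (2 * real n) / (2 * lam)) powr c = exp (c * (c * n + 2 * n)) / lam powr c" .
        moreover have "exp (c * n + c * (c * n + 2 * n) - \<delta> * n)
            = E * (exp (c * (c * n + 2 * n)) * exp (- \<delta> * n))"
          by (simp add: E_def flip: exp_add)
        ultimately show ?thesis
          by (simp add: K_def)
      qed
      also have "\<dots> \<le> K * exp (- (4 * c * n))"
      proof (rule mult_left_mono)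
        have "c * (c * n) \<le> 1 * (c * n)" "8 * c * n \<le> \<delta> * n"
          using c by (intro mult_right_mono; simp)+
        then have "c * n + c * (c * n + 2 * n) - \<delta> * n \<le> - (4 * c * n)"
          by (simp add: algebra_simps)
        then show "exp (c * n + c * (c * n + 2 * n) - \<delta> * n) \<le> exp (- (4 * c * n))"
          by simp
      qed (use lam in \<open>simp add: K_def\<close>)
      \<comment> \<open>Giving up \<open>3 * c * n\<close> in the exponent absorbs
        \<open>K\<close>.\<close>
      also have "\<dots> < exp (3 * c * n) * exp (- (4 * c * n))"
      proof (rule mult_strict_right_mono)
        have "3 * c * n0 \<le> 3 * c * n"
          using n c by simp
        then show "K < exp (3 * c * n)"
          using n0 exp_ge_add_one_self[of "3 * c * n"] by linarith
      qed simp
      also have "\<dots> = exp (- (c * n))"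
        by (simp flip: exp_add)
      finally show ?thesis
        by (simp add: E_def)
    qed
    then show ?thesis
      by (auto simp: eventually_sequentially)
  qed
  then show ?thesis
    using lam0(1) c(1) by blast
qed

end
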